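(* Suppose $T : X \to X$ is a minimal homeomorphism of a compact metric space $X$ and $f : X \to \mathbb{R}$ is continuous. Suppose further that $\nu$ is a compactly supported Borel probability measure on $\mathbb{R}$, and let $\mu = \nu^{\mathbb{Z}}$. For $x \in X$ and $\omega = (\omega_n)_{n\in\mathbb{Z}} \in (\mathrm{supp}\,\nu)^{\mathbb{Z}}$, let $H_{\omega}$ (depending also on $x$) be the operator on $\ell^2(\mathbb{Z})$ given by $$[H_\omega \psi](n) = \psi(n+1) + \psi(n-1) + \big(f(T^n x) + \omega_n\big)\psi(n).$$ Then there is a compact set $\Sigma_\nu \subset \mathbb{R}$ (not depending on $x$ and $\omega$) such that for every $x \in X$ and $\mu$-almost every $\omega$, we have $\sigma(H_\omega) = \Sigma_\nu$.
   Context: A homeomorphism $T$ of $X$ is minimal if every orbit $\{T^n x : n \in \mathbb{Z}\}$, $x \in X$, is dense in $X$. $\mathrm{supp}\,\nu$ denotes the topological support of $\nu$, and $\sigma(H)$ denotes the spectrum of $H$. *)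

theory Defs
  imports "HOL-Probability.Probability"
begin

definition int_iterate :: "'a set \<Rightarrow> ('a \<Rightarrow> 'a) \<Rightarrow> int \<Rightarrow> 'a \<Rightarrow> 'a" where
  "int_iterate X T n =
     (if 0 \<le> n then T ^^ nat n else (inv_into X T) ^^ nat (- n))"

definition minimal_homeomorphism :: "'a::topological_space set \<Rightarrow> ('a \<Rightarrow> 'a) \<Rightarrow> bool" where
  "minimal_homeomorphism X T \<longleftrightarrow>
     (\<exists>S. homeomorphism X X T S) \<and>
     (\<forall>x\<in>X. X \<subseteq> closure (range (\<lambda>n. int_iterate X T n x)))"

definition topological_support :: "'a::topological_space measure \<Rightarrow> 'a set" where
  "topological_support M = {x. \<forall>U. open U \<longrightarrow> x \<in> U \<longrightarrow> 0 < emeasure M U}"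

text \<open>The complex Hilbert space \<open>\<ell>\<^sup>2(\<int>)\<close> is a set of functions rather than a type of its
  own. Operators on it are functions on all sequences, of which only the values on
  \<open>ell2_int\<close> matter.\<close>

definition ell2_int :: "(int \<Rightarrow> complex) set" where
  "ell2_int = {\<psi>. (\<lambda>n. (cmod (\<psi> n))\<^sup>2) summable_on UNIV}"

definition ell2_norm :: "(int \<Rightarrow> complex) \<Rightarrow> real" where
  "ell2_norm \<psi> = sqrt (\<Sum>\<^sub>\<infinity>n. (cmod (\<psi> n))\<^sup>2)"

definition ell2_bounded_operator :: "((int \<Rightarrow> complex) \<Rightarrow> (int \<Rightarrow> complex)) \<Rightarrow> bool" where
  "ell2_bounded_operator A \<longleftrightarrow>
     (\<forall>\<psi>\<in>ell2_int. A \<psi> \<in> ell2_int) \<and>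
     (\<forall>\<phi>\<in>ell2_int. \<forall>\<psi>\<in>ell2_int. A (\<lambda>n. \<phi> n + \<psi> n) = (\<lambda>n. A \<phi> n + A \<psi> n)) \<and>
     (\<forall>c. \<forall>\<psi>\<in>ell2_int. A (\<lambda>n. c * \<psi> n) = (\<lambda>n. c * A \<psi> n)) \<and>
     (\<exists>C. \<forall>\<psi>\<in>ell2_int. ell2_norm (A \<psi>) \<le> C * ell2_norm \<psi>)"

text \<open>The spectrum of a bounded operator \<open>A\<close>: those \<open>z\<close> for which \<open>A - z\<close> has no
  bounded two-sided inverse on \<open>\<ell>\<^sup>2(\<int>)\<close>.\<close>

definition ell2_spectrum :: "((int \<Rightarrow> complex) \<Rightarrow> (int \<Rightarrow> complex)) \<Rightarrow> complex set" where
  "ell2_spectrum A = {z. \<not> (\<exists>B. ell2_bounded_operator B \<and>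
     (\<forall>\<psi>\<in>ell2_int. B (\<lambda>n. A \<psi> n - z * \<psi> n) = \<psi> \<and>
                   (\<lambda>n. A (B \<psi>) n - z * B \<psi> n) = \<psi>))}"

definition schroedinger :: "(int \<Rightarrow> real) \<Rightarrow> (int \<Rightarrow> complex) \<Rightarrow> (int \<Rightarrow> complex)" where
  "schroedinger V \<psi> = (\<lambda>n. \<psi> (n + 1) + \<psi> (n - 1) + complex_of_real (V n) * \<psi> n)"

lemma ell2_bounded_operator_schroedinger:
  assumes V: "\<And>n. \<bar>V n\<bar> \<le> K"
  shows "ell2_bounded_operator (schroedinger V)"
proof -
  have main: "schroedinger V \<psi> \<in> ell2_int \<and>
      ell2_norm (schroedinger V \<psi>) \<le> sqrt (3 * (2 + K\<^sup>2)) * ell2_norm \<psi>"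
    if "\<psi> \<in> ell2_int" for \<psi>
  proof -
    let ?g = "\<lambda>n. (cmod (\<psi> n))\<^sup>2"
    let ?h = "\<lambda>n. (cmod (schroedinger V \<psi> n))\<^sup>2"
    have g: "?g summable_on UNIV" using that by (simp add: ell2_int_def)
    have bij: "bij_betw (\<lambda>n::int. n + c) UNIV UNIV" for c
      by (rule bij_betwI[where g = "\<lambda>n. n - c"]) auto
    have gs: "(\<lambda>n. ?g (n + c)) summable_on UNIV" for c
      using summable_on_reindex_bij_betw[OF bij[of c], of ?g] g by simp
    have ish: "(\<Sum>\<^sub>\<infinity>n. ?g (n + c)) = (\<Sum>\<^sub>\<infinity>n. ?g n)" for c
      using infsum_reindex_bij_betw[OF bij[of c], of ?g] by simp
    have le: "?h n \<le> 3 * (?g (n + 1) + ?g (n + (- 1)) + K\<^sup>2 * ?g n)" for n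
    proof -
      let ?a = "cmod (\<psi> (n + 1))" and ?b = "cmod (\<psi> (n - 1))" and ?c = "\<bar>V n\<bar> * cmod (\<psi> n)"
      have "cmod (schroedinger V \<psi> n) \<le> ?a + ?b + ?c"
        unfolding schroedinger_def
        by (intro norm_triangle_le add_mono) (simp_all add: norm_mult norm_triangle_ineq)
      hence "?h n \<le> (?a + ?b + ?c)\<^sup>2" by (rule power_mono) simp
      also have "\<dots> \<le> 3 * (?a\<^sup>2 + ?b\<^sup>2 + ?c\<^sup>2)"
      proof -
        have "0 \<le> (?a - ?b)\<^sup>2 + (?a - ?c)\<^sup>2 + (?b - ?c)\<^sup>2" by simp
        thus ?thesis unfolding power2_eq_square by (simp only: algebra_simps)
      qed
      also have "?c\<^sup>2 \<le> K\<^sup>2 * ?g n"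
        unfolding power_mult_distrib
        by (intro mult_right_mono power_mono V) auto
      finally show ?thesis by simp
    qed
    have G: "(\<lambda>n. 3 * (?g (n + 1) + ?g (n + (- 1)) + K\<^sup>2 * ?g n)) summable_on UNIV"
      by (intro summable_on_cmult_right summable_on_add gs g)
    have h: "?h summable_on UNIV"
      by (rule summable_on_comparison_test[OF G]) (use le in auto)
    have "infsum ?h UNIV \<le> (\<Sum>\<^sub>\<infinity>n. 3 * (?g (n + 1) + ?g (n + (- 1)) + K\<^sup>2 * ?g n))"
      by (rule infsum_mono[OF h G le])
    also have "\<dots> = 3 * ((\<Sum>\<^sub>\<infinity>n. ?g n) + (\<Sum>\<^sub>\<infinity>n. ?g n) + K\<^sup>2 * (\<Sum>\<^sub>\<infinity>n. ?g n))"
      unfolding infsum_cmult_right'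
      by (simp only: infsum_add[OF summable_on_add[OF gs gs] summable_on_cmult_right[OF g]]
            infsum_add[OF gs gs] ish infsum_cmult_right')
    also have "\<dots> = 3 * (2 + K\<^sup>2) * (\<Sum>\<^sub>\<infinity>n. ?g n)" by (simp add: algebra_simps)
    finally show ?thesis
      using h by (auto simp: ell2_int_def ell2_norm_def real_sqrt_mult[symmetric])
  qed
  have "\<exists>C. \<forall>\<psi>\<in>ell2_int. ell2_norm (schroedinger V \<psi>) \<le> C * ell2_norm \<psi>"
    using main by blast
  thus ?thesis
    using main unfolding ell2_bounded_operator_def
    by (auto simp: schroedinger_def algebra_simps)
qed

end

theory Submission
  imports Defs
begin

text \<open>Write \<open>V\<close> for the potential \<open>V n = f (T\<^sup>n x) + \<omega> n\<close>, \<open>H\<close> for its Schroedinger operator and \<open>K\<close>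
  for the support of \<open>\<nu>\<close>. The set \<open>\<Sigma>\<close> is the union of the spectra of all these operators, over all
  points of \<open>X\<close> and all sequences in \<open>K\<close>. Every spectrum is contained in \<open>\<Sigma>\<close>; the claim is that, for
  each \<open>x\<close> and almost every \<open>\<omega>\<close>, the potential \<open>V\<close> is rich enough for its spectrum to be all of \<open>\<Sigma>\<close>.

  The operator \<open>H\<close> is bounded and symmetric, so its spectrum is real and consists of the \<open>z\<close> at which
  \<open>H - z\<close> is not bounded below (\<open>ell2_spectrum_schroedinger\<close>). The nontrivial half is that a
  lower bound implies surjectivity, which is obtained from an explicit Neumann series
  (\<open>surjective_of_bounded_below\<close>). In this form two facts are elementary: the spectrum is compact, and if
  \<open>W\<close> is a pointwise limit of translates of \<open>V\<close>, then the spectrum for \<open>W\<close> is contained in the spectrum for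
  \<open>V\<close> (\<open>approximate_eigenvalues_limit_of_translates\<close>), since a lower bound for \<open>V\<close> holds for each
  translate and passes to the limit.

  It remains to see that almost every \<open>V\<close> has every other potential of the family, given by \<open>y\<close> and
  \<open>w\<close>, as a limit of translates. By minimality and compactness the orbit of \<open>x\<close> follows that of \<open>y\<close>,
  for any given stretch of time and accuracy, from infinitely many starting times
  (\<open>recurrent_limit_minimal\<close>). Among these infinitely many positions the zero-one law provides one at
  which \<open>\<omega>\<close> also follows \<open>w\<close>, since a neighbourhood of a block of points of \<open>K\<close> has positive probability
  (\<open>AE_block_occurs\<close>). Approximation by rational blocks collects all these requirements into
  countably many (\<open>AE_limit_of_translates\<close>), so a single null set of \<open>\<omega>\<close> has to be discarded for each
  \<open>x\<close>. For any remaining \<open>\<omega>\<close> the spectrum is \<open>\<Sigma>\<close>, so \<open>\<Sigma>\<close> is compact (and empty if \<open>X\<close> is).\<close>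

section \<open>The sequence space\<close>

lemma ell2_norm_nonneg [simp]: "0 \<le> ell2_norm \<psi>"
  by (simp add: ell2_norm_def infsum_nonneg)

lemma ell2_norm_power2: "(ell2_norm \<psi>)\<^sup>2 = (\<Sum>\<^sub>\<infinity>n. (cmod (\<psi> n))\<^sup>2)"
  by (simp add: ell2_norm_def infsum_nonneg)

text \<open>Membership and norm bounds are decided on finite sets of coordinates. This gives the triangle
  inequality, and it lets norm bounds pass to coordinatewise limits.\<close>

lemma L2_set_le_ell2_norm:
  assumes "\<psi> \<in> ell2_int" "finite F"
  shows "L2_set (\<lambda>n. cmod (\<psi> n)) F \<le> ell2_norm \<psi>"
  unfolding L2_set_def ell2_norm_def
  using assms by (intro real_sqrt_le_mono finite_sum_le_infsum) (auto simp: ell2_int_def)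

lemma ell2_norm_le_finite:
  assumes "\<And>F. finite F \<Longrightarrow> L2_set (\<lambda>n. cmod (\<psi> n)) F \<le> C"
  shows "\<psi> \<in> ell2_int" "ell2_norm \<psi> \<le> C"
proof -
  have C: "0 \<le> C" using assms[of "{}"] by simp
  have sums: "(\<Sum>n\<in>F. (cmod (\<psi> n))\<^sup>2) \<le> C\<^sup>2" if "finite F" for F
    using assms[OF that] C unfolding L2_set_def
    by (metis real_sqrt_le_iff real_sqrt_abs abs_of_nonneg)
  have "(\<lambda>n. (cmod (\<psi> n))\<^sup>2) summable_on UNIV"
    by (rule nonneg_bdd_above_summable_on) (auto intro!: bdd_aboveI[of _ "C\<^sup>2"] sums)
  thus "\<psi> \<in> ell2_int" by (simp add: ell2_int_def)
  have "(ell2_norm \<psi>)\<^sup>2 \<le> C\<^sup>2" unfolding ell2_norm_power2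
    by (rule infsum_le_finite_sums) (use sums \<open>_ summable_on _\<close> in auto)
  thus "ell2_norm \<psi> \<le> C" using C by (rule power2_le_imp_le)
qed

lemma cmod_le_ell2_norm: "\<psi> \<in> ell2_int \<Longrightarrow> cmod (\<psi> n) \<le> ell2_norm \<psi>"
  using L2_set_le_ell2_norm[of \<psi> "{n}"] by simp

lemma
  assumes "\<phi> \<in> ell2_int" "\<psi> \<in> ell2_int"
  shows ell2_int_add: "(\<lambda>n. \<phi> n + \<psi> n) \<in> ell2_int"
    and ell2_norm_triangle: "ell2_norm (\<lambda>n. \<phi> n + \<psi> n) \<le> ell2_norm \<phi> + ell2_norm \<psi>"
proof -
  have "L2_set (\<lambda>n. cmod (\<phi> n + \<psi> n)) F \<le> ell2_norm \<phi> + ell2_norm \<psi>" if "finite F" for F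
  proof -
    have "L2_set (\<lambda>n. cmod (\<phi> n + \<psi> n)) F \<le> L2_set (\<lambda>n. cmod (\<phi> n) + cmod (\<psi> n)) F"
      by (intro L2_set_mono norm_triangle_ineq) auto
    also have "\<dots> \<le> L2_set (\<lambda>n. cmod (\<phi> n)) F + L2_set (\<lambda>n. cmod (\<psi> n)) F"
      by (rule L2_set_triangle_ineq)
    also have "\<dots> \<le> ell2_norm \<phi> + ell2_norm \<psi>"
      by (intro add_mono L2_set_le_ell2_norm assms that)
    finally show ?thesis .
  qed
  from ell2_norm_le_finite[OF this]
  show "(\<lambda>n. \<phi> n + \<psi> n) \<in> ell2_int"
    and "ell2_norm (\<lambda>n. \<phi> n + \<psi> n) \<le> ell2_norm \<phi> + ell2_norm \<psi>" by auto
qed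

lemma ell2_int_cmult: "\<psi> \<in> ell2_int \<Longrightarrow> (\<lambda>n. c * \<psi> n) \<in> ell2_int"
  unfolding ell2_int_def
  by (auto simp: norm_mult power_mult_distrib intro!: summable_on_cmult_right)

lemma ell2_norm_cmult: "ell2_norm (\<lambda>n. c * \<psi> n) = cmod c * ell2_norm \<psi>"
  by (simp add: ell2_norm_def norm_mult power_mult_distrib infsum_cmult_right' real_sqrt_mult)

lemma ell2_int_diff: "\<phi> \<in> ell2_int \<Longrightarrow> \<psi> \<in> ell2_int \<Longrightarrow> (\<lambda>n. \<phi> n - \<psi> n) \<in> ell2_int"
  using ell2_int_add[of \<phi> "\<lambda>n. (-1) * \<psi> n"] ell2_int_cmult[of \<psi> "-1"] by simp

lemma ell2_norm_triangle_diff: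
  "\<phi> \<in> ell2_int \<Longrightarrow> \<psi> \<in> ell2_int \<Longrightarrow>
    ell2_norm (\<lambda>n. \<phi> n - \<psi> n) \<le> ell2_norm \<phi> + ell2_norm \<psi>"
  using ell2_norm_triangle[of \<phi> "\<lambda>n. (-1) * \<psi> n"] ell2_int_cmult[of \<psi> "-1"]
    ell2_norm_cmult[of "-1" \<psi>] by simp

lemma bij_translate: "bij_betw (\<lambda>n::int. n + m) UNIV UNIV"
  by (rule bij_betwI[where g = "\<lambda>n. n - m"]) auto

lemma ell2_int_shift: "\<psi> \<in> ell2_int \<Longrightarrow> (\<lambda>n. \<psi> (n + m)) \<in> ell2_int"
  using summable_on_reindex_bij_betw[OF bij_translate[of m], of "\<lambda>n. (cmod (\<psi> n))\<^sup>2"]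
  by (simp add: ell2_int_def)

lemma ell2_norm_shift: "ell2_norm (\<lambda>n. \<psi> (n + m)) = ell2_norm \<psi>"
  using infsum_reindex_bij_betw[OF bij_translate[of m], of "\<lambda>n. (cmod (\<psi> n))\<^sup>2"]
  by (simp add: ell2_norm_def)

text \<open>The real part of the complex inner product suffices: it determines the norm, and the real
  adjoint of multiplication by a complex number is multiplication by its conjugate.\<close>

definition ell2_inner :: "(int \<Rightarrow> complex) \<Rightarrow> (int \<Rightarrow> complex) \<Rightarrow> real" where
  "ell2_inner \<phi> \<psi> = (\<Sum>\<^sub>\<infinity>n. \<phi> n \<bullet> \<psi> n)"

lemma ell2_inner_summable:
  assumes "\<phi> \<in> ell2_int" "\<psi> \<in> ell2_int"
  shows "(\<lambda>n. \<phi> n \<bullet> \<psi> n) summable_on UNIV"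
proof (rule abs_summable_summable)
  have "(\<lambda>n. (cmod (\<phi> n))\<^sup>2 + (cmod (\<psi> n))\<^sup>2) summable_on UNIV"
    using assms unfolding ell2_int_def by (auto intro: summable_on_add)
  thus "(\<lambda>n. norm (\<phi> n \<bullet> \<psi> n)) summable_on UNIV"
  proof (rule summable_on_comparison_test)
    fix n
    have "norm (\<phi> n \<bullet> \<psi> n) \<le> cmod (\<phi> n) * cmod (\<psi> n)"
      by (simp add: Cauchy_Schwarz_ineq2)
    also have "\<dots> \<le> (cmod (\<phi> n))\<^sup>2 + (cmod (\<psi> n))\<^sup>2"
      using sum_squares_bound[of "cmod (\<phi> n)" "cmod (\<psi> n)"]
        mult_nonneg_nonneg[OF norm_ge_zero norm_ge_zero, of "\<phi> n" "\<psi> n"] by linarith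
    finally show "norm (\<phi> n \<bullet> \<psi> n) \<le> (cmod (\<phi> n))\<^sup>2 + (cmod (\<psi> n))\<^sup>2" .
  qed auto
qed

lemma ell2_inner_self: "ell2_inner \<psi> \<psi> = (ell2_norm \<psi>)\<^sup>2"
  by (simp add: ell2_inner_def ell2_norm_power2 dot_square_norm)

lemma ell2_inner_commute: "ell2_inner \<phi> \<psi> = ell2_inner \<psi> \<phi>"
  by (simp add: ell2_inner_def inner_commute)

lemma ell2_inner_add_left:
  "\<lbrakk>\<phi> \<in> ell2_int; \<phi>' \<in> ell2_int; \<psi> \<in> ell2_int\<rbrakk> \<Longrightarrow>
    ell2_inner (\<lambda>n. \<phi> n + \<phi>' n) \<psi> = ell2_inner \<phi> \<psi> + ell2_inner \<phi>' \<psi>"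
  unfolding ell2_inner_def inner_add_left by (intro infsum_add ell2_inner_summable)

lemma ell2_inner_add_right:
  "\<lbrakk>\<phi> \<in> ell2_int; \<psi> \<in> ell2_int; \<psi>' \<in> ell2_int\<rbrakk> \<Longrightarrow>
    ell2_inner \<phi> (\<lambda>n. \<psi> n + \<psi>' n) = ell2_inner \<phi> \<psi> + ell2_inner \<phi> \<psi>'"
  unfolding ell2_inner_def inner_add_right by (intro infsum_add ell2_inner_summable)

lemma ell2_inner_of_real_right:
  "ell2_inner \<phi> (\<lambda>n. complex_of_real r * \<psi> n) = r * ell2_inner \<phi> \<psi>"
proof -
  have "\<phi> n \<bullet> (complex_of_real r * \<psi> n) = r * (\<phi> n \<bullet> \<psi> n)" for n
    by (simp add: inner_complex_def algebra_simps)
  thus ?thesis by (simp add: ell2_inner_def infsum_cmult_right')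
qed

lemma ell2_inner_mult_left: "ell2_inner (\<lambda>n. c n * \<phi> n) \<psi> = ell2_inner \<phi> (\<lambda>n. cnj (c n) * \<psi> n)"
  unfolding ell2_inner_def by (intro infsum_cong) (simp add: inner_complex_def algebra_simps)

lemma ell2_inner_shift_left: "ell2_inner (\<lambda>n. \<phi> (n + m)) \<psi> = ell2_inner \<phi> (\<lambda>n. \<psi> (n - m))"
  using infsum_reindex_bij_betw[OF bij_translate[of m], of "\<lambda>n. \<phi> n \<bullet> \<psi> (n - m)"]
  by (simp add: ell2_inner_def)

lemma ell2_norm_add_power2:
  assumes "\<phi> \<in> ell2_int" "\<psi> \<in> ell2_int"
  shows "(ell2_norm (\<lambda>n. \<phi> n + complex_of_real r * \<psi> n))\<^sup>2 =
    (ell2_norm \<phi>)\<^sup>2 + 2 * r * ell2_inner \<phi> \<psi> + r\<^sup>2 * (ell2_norm \<psi>)\<^sup>2"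
proof -
  let ?s = "\<lambda>n. complex_of_real r * \<psi> n"
  have s: "?s \<in> ell2_int" using assms ell2_int_cmult by blast
  have "(ell2_norm (\<lambda>n. \<phi> n + ?s n))\<^sup>2 =
      ell2_inner \<phi> \<phi> + ell2_inner \<phi> ?s + (ell2_inner ?s \<phi> + ell2_inner ?s ?s)"
    unfolding ell2_inner_self[symmetric]
    by (simp add: ell2_inner_add_left ell2_inner_add_right assms s ell2_int_add)
  moreover have "ell2_inner ?s \<phi> = ell2_inner \<phi> ?s" by (rule ell2_inner_commute)
  moreover have "ell2_inner ?s ?s = r\<^sup>2 * ell2_inner \<psi> \<psi>"
    by (simp add: ell2_inner_of_real_right ell2_inner_commute[of ?s] power2_eq_square)
  ultimately show ?thesis by (simp add: ell2_inner_of_real_right ell2_inner_self)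
qed

section \<open>The Weyl criterion for Schroedinger operators\<close>

definition schroedinger_minus :: "(int \<Rightarrow> real) \<Rightarrow> complex \<Rightarrow> (int \<Rightarrow> complex) \<Rightarrow> int \<Rightarrow> complex" where
  "schroedinger_minus V z \<psi> = (\<lambda>n. schroedinger V \<psi> n - z * \<psi> n)"

definition bounded_below :: "(int \<Rightarrow> real) \<Rightarrow> complex \<Rightarrow> real \<Rightarrow> bool" where
  "bounded_below V z c \<longleftrightarrow>
    (\<forall>\<psi>\<in>ell2_int. c * ell2_norm \<psi> \<le> ell2_norm (schroedinger_minus V z \<psi>))"

lemma schroedinger_minus_add:
  "schroedinger_minus V z (\<lambda>n. \<phi> n + \<psi> n) =
    (\<lambda>n. schroedinger_minus V z \<phi> n + schroedinger_minus V z \<psi> n)"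
  by (auto simp: schroedinger_minus_def schroedinger_def algebra_simps)

lemma schroedinger_minus_diff:
  "schroedinger_minus V z (\<lambda>n. \<phi> n - \<psi> n) =
    (\<lambda>n. schroedinger_minus V z \<phi> n - schroedinger_minus V z \<psi> n)"
  by (auto simp: schroedinger_minus_def schroedinger_def algebra_simps)

lemma schroedinger_minus_cmult:
  "schroedinger_minus V z (\<lambda>n. c * \<psi> n) = (\<lambda>n. c * schroedinger_minus V z \<psi> n)"
  by (auto simp: schroedinger_minus_def schroedinger_def algebra_simps)

lemma schroedinger_minus_sums:
  assumes "\<And>n. (\<lambda>k. e k n) sums u n"
  shows "(\<lambda>k. schroedinger_minus V z (e k) n) sums schroedinger_minus V z u n"
  unfolding schroedinger_minus_def schroedinger_def
  by (intro sums_diff sums_add sums_mult assms)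

context
  fixes V :: "int \<Rightarrow> real"
  assumes V: "bounded (range V)"
begin

lemma bounded_operator: "ell2_bounded_operator (schroedinger V)"
proof -
  obtain K where "\<forall>n. \<bar>V n\<bar> \<le> K" using V by (auto simp: bounded_iff)
  thus ?thesis by (blast intro: ell2_bounded_operator_schroedinger)
qed

lemma schroedinger_in_ell2: "\<psi> \<in> ell2_int \<Longrightarrow> schroedinger V \<psi> \<in> ell2_int"
  using bounded_operator unfolding ell2_bounded_operator_def by blast

lemma schroedinger_minus_in_ell2: "\<psi> \<in> ell2_int \<Longrightarrow> schroedinger_minus V z \<psi> \<in> ell2_int"
  unfolding schroedinger_minus_def by (intro ell2_int_diff schroedinger_in_ell2 ell2_int_cmult)

lemma schroedinger_norm_bound:
  obtains C where "0 \<le> C" "\<And>\<psi>. \<psi> \<in> ell2_int \<Longrightarrow> ell2_norm (schroedinger V \<psi>) \<le> C * ell2_norm \<psi>"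
proof -
  obtain C where C: "\<forall>\<psi>\<in>ell2_int. ell2_norm (schroedinger V \<psi>) \<le> C * ell2_norm \<psi>"
    using bounded_operator unfolding ell2_bounded_operator_def by blast
  have "ell2_norm (schroedinger V \<psi>) \<le> \<bar>C\<bar> * ell2_norm \<psi>" if "\<psi> \<in> ell2_int" for \<psi>
    using C that by (meson abs_ge_self ell2_norm_nonneg mult_right_mono order_trans)
  thus thesis by (rule that[rotated]) auto
qed

lemma schroedinger_symmetric:
  assumes "\<phi> \<in> ell2_int" "\<psi> \<in> ell2_int"
  shows "ell2_inner (schroedinger V \<phi>) \<psi> = ell2_inner \<phi> (schroedinger V \<psi>)"
proof -
  let ?V = "\<lambda>n. complex_of_real (V n)"
  have mult: "(\<lambda>n. ?V n * \<psi> n) \<in> ell2_int" if "\<psi> \<in> ell2_int" for \<psi>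
  proof -
    have "(\<lambda>n. schroedinger V \<psi> n - (\<psi> (n + 1) + \<psi> (n + (-1)))) \<in> ell2_int"
      by (intro ell2_int_diff ell2_int_add ell2_int_shift schroedinger_in_ell2 that)
    thus ?thesis by (simp add: schroedinger_def)
  qed
  have split: "ell2_inner (schroedinger V \<phi>) \<psi> = ell2_inner (\<lambda>n. \<phi> (n + 1)) \<psi>
      + ell2_inner (\<lambda>n. \<phi> (n + (-1))) \<psi> + ell2_inner (\<lambda>n. ?V n * \<phi> n) \<psi>"
    if "\<phi> \<in> ell2_int" "\<psi> \<in> ell2_int" for \<phi> \<psi>
    using that unfolding schroedinger_def
    by (simp add: ell2_inner_add_left mult ell2_int_shift[of _ "-1", simplified]
        ell2_int_shift ell2_int_add)
  show ?thesis
    unfolding ell2_inner_commute[of \<phi> "schroedinger V \<psi>"] split[OF assms] split[OF assms(2,1)]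
      ell2_inner_shift_left ell2_inner_mult_left
    by (simp add: ell2_inner_commute[of \<psi>] ell2_inner_shift_left[of \<phi> 1, simplified, symmetric]
        ell2_inner_shift_left[of \<phi> "-1", simplified, symmetric] ell2_inner_mult_left)
qed

lemma schroedinger_minus_adjoint:
  assumes "\<phi> \<in> ell2_int" "\<psi> \<in> ell2_int"
  shows "ell2_inner (schroedinger_minus V z \<phi>) \<psi> = ell2_inner \<phi> (schroedinger_minus V (cnj z) \<psi>)"
proof -
  have "ell2_inner (\<lambda>n. schroedinger V \<phi> n + (- z) * \<phi> n) \<psi>
      = ell2_inner \<phi> (\<lambda>n. schroedinger V \<psi> n + cnj (- z) * \<psi> n)"
    unfolding ell2_inner_add_left[OF schroedinger_in_ell2 ell2_int_cmult, OF assms(1,1,2)]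
      ell2_inner_add_right[OF assms(1) schroedinger_in_ell2 ell2_int_cmult, OF assms(2,2)]
      schroedinger_symmetric[OF assms] ell2_inner_mult_left ..
  thus ?thesis by (simp add: schroedinger_minus_def)
qed

text \<open>For \<open>z = a + i b\<close> the cross term in \<open>\<parallel>(H - a) \<psi> - i b \<psi>\<parallel>\<^sup>2\<close> vanishes because \<open>H - a\<close> is
  symmetric.\<close>

lemma bounded_below_Im: "bounded_below V z \<bar>Im z\<bar>"
  unfolding bounded_below_def
proof
  fix \<psi> :: "int \<Rightarrow> complex" assume \<psi>: "\<psi> \<in> ell2_int"
  let ?S = "schroedinger_minus V (complex_of_real (Re z))"
  let ?i = "\<lambda>n. \<i> * \<psi> n"
  have i: "?i \<in> ell2_int" using \<psi> by (rule ell2_int_cmult)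
  have S: "?S \<psi> \<in> ell2_int" using \<psi> by (rule schroedinger_minus_in_ell2)
  have "ell2_inner (?S \<psi>) ?i = ell2_inner \<psi> (?S ?i)"
    using schroedinger_minus_adjoint[OF \<psi> i, of "complex_of_real (Re z)"] by simp
  also have "\<dots> = ell2_inner \<psi> (\<lambda>n. cnj (- \<i>) * ?S \<psi> n)"
    by (simp add: schroedinger_minus_cmult)
  also have "\<dots> = ell2_inner (\<lambda>n. - \<i> * \<psi> n) (?S \<psi>)"
    by (rule ell2_inner_mult_left[symmetric])
  also have "\<dots> = ell2_inner (?S \<psi>) (\<lambda>n. complex_of_real (-1) * ?i n)"
    by (simp add: ell2_inner_commute)
  also have "\<dots> = - ell2_inner (?S \<psi>) ?i"
    unfolding ell2_inner_of_real_right by simp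
  finally have cross: "ell2_inner (?S \<psi>) ?i = 0" by simp
  have "schroedinger_minus V z \<psi> = (\<lambda>n. ?S \<psi> n + complex_of_real (- Im z) * ?i n)"
  proof
    fix n
    have "z * \<psi> n = (complex_of_real (Re z) + \<i> * complex_of_real (Im z)) * \<psi> n"
      by (simp add: complex_eq[symmetric])
    thus "schroedinger_minus V z \<psi> n = ?S \<psi> n + complex_of_real (- Im z) * ?i n"
      by (simp add: schroedinger_minus_def algebra_simps)
  qed
  hence "(ell2_norm (schroedinger_minus V z \<psi>))\<^sup>2
      = (ell2_norm (?S \<psi>))\<^sup>2 + (Im z)\<^sup>2 * (ell2_norm ?i)\<^sup>2"
    using ell2_norm_add_power2[OF S i, of "- Im z"] cross by simp
  also have "ell2_norm ?i = ell2_norm \<psi>" by (simp add: ell2_norm_cmult)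
  finally have "(\<bar>Im z\<bar> * ell2_norm \<psi>)\<^sup>2 \<le> (ell2_norm (schroedinger_minus V z \<psi>))\<^sup>2"
    by (simp add: power_mult_distrib)
  thus "\<bar>Im z\<bar> * ell2_norm \<psi> \<le> ell2_norm (schroedinger_minus V z \<psi>)"
    by (rule power2_le_imp_le) simp
qed

lemma schroedinger_minus_norm_bound:
  obtains M where "0 \<le> M"
    "\<And>\<psi>. \<psi> \<in> ell2_int \<Longrightarrow> ell2_norm (schroedinger_minus V z \<psi>) \<le> M * ell2_norm \<psi>"
proof -
  obtain C where C: "0 \<le> C" "\<And>\<psi>. \<psi> \<in> ell2_int \<Longrightarrow> ell2_norm (schroedinger V \<psi>) \<le> C * ell2_norm \<psi>"
    using schroedinger_norm_bound by blast
  have "ell2_norm (schroedinger_minus V z \<psi>) \<le> (C + cmod z) * ell2_norm \<psi>" if "\<psi> \<in> ell2_int" for \<psi>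
    using ell2_norm_triangle_diff[OF schroedinger_in_ell2 ell2_int_cmult, OF that that, of z] C(2)[OF that]
    by (simp add: schroedinger_minus_def ell2_norm_cmult algebra_simps)
  thus thesis using C(1) by (intro that[of "C + cmod z"]) auto
qed

text \<open>Let \<open>D = H - z\<close>, whose adjoint is \<open>D\<^sup>* = H - cnj z\<close>, and suppose \<open>c \<parallel>\<psi>\<parallel> \<le> \<parallel>D \<psi>\<parallel>\<close> for all
  \<open>\<psi>\<close>. Once \<open>M\<close> bounds the norm of \<open>D\<^sup>*\<close>, the operator \<open>R = 1 - D\<^sup>* D / M\<^sup>2\<close> is a strict contraction:
  the square of \<open>\<parallel>R \<psi>\<parallel>\<close> equals \<open>\<parallel>\<psi>\<parallel>\<^sup>2 - 2 \<parallel>D \<psi>\<parallel>\<^sup>2 / M\<^sup>2 + \<parallel>D\<^sup>* D \<psi>\<parallel>\<^sup>2 / M\<^sup>4\<close>, which is at most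
  \<open>\<parallel>\<psi>\<parallel>\<^sup>2 - \<parallel>D \<psi>\<parallel>\<^sup>2 / M\<^sup>2 \<le> (1 - c\<^sup>2 / M\<^sup>2) \<parallel>\<psi>\<parallel>\<^sup>2\<close>. The Neumann series of \<open>R\<close> then solves
  \<open>D\<^sup>* D u = \<eta>\<close>, so \<open>v = D u\<close> solves \<open>D\<^sup>* v = \<eta>\<close>. The series is summed coordinate by coordinate;
  this suffices because \<open>D\<^sup>* D\<close> couples only finitely many coordinates, and the uniform bound on
  the norms of the partial sums places the limit in \<open>\<ell>\<^sup>2(\<int>)\<close>.\<close>

lemma surjective_of_bounded_below:
  assumes c: "0 < c" "bounded_below V z c" and \<eta>: "\<eta> \<in> ell2_int"
  shows "\<exists>v\<in>ell2_int. schroedinger_minus V (cnj z) v = \<eta>"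
proof -
  let ?D = "schroedinger_minus V z" and ?E = "schroedinger_minus V (cnj z)"
  obtain M0 where M0: "0 \<le> M0" "\<And>\<psi>. \<psi> \<in> ell2_int \<Longrightarrow> ell2_norm (?E \<psi>) \<le> M0 * ell2_norm \<psi>"
    using schroedinger_minus_norm_bound by blast
  \<comment> \<open>At least \<open>c\<close>, so that the contraction factor \<open>q\<close> is the square root of a nonnegative number.\<close>
  define M where "M = max M0 c"
  have M: "0 < M" "c \<le> M" using c by (auto simp: M_def)
  have EM: "ell2_norm (?E \<psi>) \<le> M * ell2_norm \<psi>" if "\<psi> \<in> ell2_int" for \<psi>
    using M0(2)[OF that] by (rule order_trans) (simp add: M_def mult_right_mono)
  define \<tau> where "\<tau> = 1 / M\<^sup>2"
  have \<tau>: "0 < \<tau>" "\<tau> * M\<^sup>2 = 1" using M by (auto simp: \<tau>_def)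
  define q where "q = sqrt (1 - \<tau> * c\<^sup>2)"
  have "\<tau> * c\<^sup>2 \<le> \<tau> * M\<^sup>2" using \<tau> c M by (intro mult_left_mono power_mono) auto
  hence q2: "q\<^sup>2 = 1 - \<tau> * c\<^sup>2" using \<tau> by (simp add: q_def)
  have q: "0 \<le> q" "q < 1" using \<open>\<tau> * c\<^sup>2 \<le> \<tau> * M\<^sup>2\<close> \<tau> c by (auto simp: q_def)
  define R where "R \<psi> = (\<lambda>n. \<psi> n + complex_of_real (- \<tau>) * ?E (?D \<psi>) n)" for \<psi>
  have R: "R \<psi> \<in> ell2_int" if "\<psi> \<in> ell2_int" for \<psi>
    unfolding R_def by (intro ell2_int_add ell2_int_cmult schroedinger_minus_in_ell2 that)
  have contraction: "ell2_norm (R \<psi>) \<le> q * ell2_norm \<psi>" if \<psi>: "\<psi> \<in> ell2_int" for \<psi>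
  proof -
    let ?d = "(ell2_norm (?D \<psi>))\<^sup>2"
    have D: "?D \<psi> \<in> ell2_int" and ED: "?E (?D \<psi>) \<in> ell2_int"
      using \<psi> by (auto intro: schroedinger_minus_in_ell2)
    have "ell2_inner \<psi> (?E (?D \<psi>)) = ?d"
      using schroedinger_minus_adjoint[OF \<psi> D, of z] by (simp add: ell2_inner_self)
    hence "(ell2_norm (R \<psi>))\<^sup>2 = (ell2_norm \<psi>)\<^sup>2 - 2 * \<tau> * ?d + \<tau>\<^sup>2 * (ell2_norm (?E (?D \<psi>)))\<^sup>2"
      unfolding R_def ell2_norm_add_power2[OF \<psi> ED] by simp
    also have "\<dots> \<le> (ell2_norm \<psi>)\<^sup>2 - 2 * \<tau> * ?d + \<tau>\<^sup>2 * (M\<^sup>2 * ?d)"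
      unfolding power_mult_distrib[symmetric, of M]
      by (intro add_left_mono mult_left_mono power_mono EM D) auto
    also have "\<tau>\<^sup>2 * (M\<^sup>2 * ?d) = \<tau> * (\<tau> * M\<^sup>2) * ?d" by (simp add: power2_eq_square)
    also have "\<dots> = \<tau> * ?d" using \<tau> by simp
    also have "(ell2_norm \<psi>)\<^sup>2 - 2 * \<tau> * ?d + \<tau> * ?d = (ell2_norm \<psi>)\<^sup>2 - \<tau> * ?d" by simp
    also have "\<dots> \<le> (ell2_norm \<psi>)\<^sup>2 - \<tau> * (c * ell2_norm \<psi>)\<^sup>2"
      using c \<psi> \<tau> unfolding bounded_below_def
      by (intro diff_left_mono mult_left_mono power_mono) auto
    also have "\<dots> = (q * ell2_norm \<psi>)\<^sup>2"
      unfolding power_mult_distrib q2 by (simp add: algebra_simps)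
    finally show ?thesis by (rule power2_le_imp_le) (use q in simp)
  qed
  define e where "e k = (R ^^ k) (\<lambda>n. complex_of_real \<tau> * \<eta> n)" for k
  define a where "a = ell2_norm (e 0)"
  have e: "e k \<in> ell2_int \<and> ell2_norm (e k) \<le> a * q ^ k" for k
  proof (induction k)
    case 0
    show ?case using \<eta> by (auto simp: e_def a_def intro: ell2_int_cmult)
  next
    case (Suc k)
    have "ell2_norm (e (Suc k)) \<le> q * ell2_norm (e k)"
      using Suc contraction by (simp add: e_def)
    also have "\<dots> \<le> q * (a * q ^ k)" using Suc q by (intro mult_left_mono) auto
    finally show ?case using Suc R by (simp add: e_def algebra_simps)
  qed
  have pt: "cmod (e k n) \<le> a * q ^ k" for k n
    using e[of k] cmod_le_ell2_norm[of "e k" n] by linarith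
  have geo: "(\<lambda>k. a * q ^ k) sums (a * (1 / (1 - q)))"
    using q by (intro sums_mult geometric_sums) auto
  have "summable (\<lambda>k. e k n)" for n
    by (rule summable_comparison_test'[OF sums_summable[OF geo], of 0]) (rule pt)
  then obtain u where u: "\<And>n. (\<lambda>k. e k n) sums u n"
    unfolding summable_def by metis
  have u_ell2: "u \<in> ell2_int"
  proof (rule ell2_norm_le_finite)
    fix F :: "int set" assume F: "finite F"
    have partial: "(\<lambda>n. \<Sum>k<m. e k n) \<in> ell2_int \<and>
        ell2_norm (\<lambda>n. \<Sum>k<m. e k n) \<le> (\<Sum>k<m. a * q ^ k)" for m
    proof (induction m)
      case 0
      have "L2_set (\<lambda>n. cmod ((\<lambda>_. 0) n)) F \<le> 0" for F :: "int set" by (simp add: L2_set_0')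
      from ell2_norm_le_finite[OF this] show ?case by simp
    next
      case (Suc m)
      have "ell2_norm (\<lambda>n. (\<Sum>k<m. e k n) + e m n)
          \<le> ell2_norm (\<lambda>n. \<Sum>k<m. e k n) + ell2_norm (e m)"
        using Suc e by (intro ell2_norm_triangle) auto
      thus ?case using Suc e[of m] ell2_int_add[of "\<lambda>n. \<Sum>k<m. e k n" "e m"] by simp
    qed
    have "(\<lambda>m. L2_set (\<lambda>n. cmod (\<Sum>k<m. e k n)) F) \<longlonglongrightarrow> L2_set (\<lambda>n. cmod (u n)) F"
      unfolding L2_set_def using u[unfolded sums_def] by (intro tendsto_intros)
    moreover have "L2_set (\<lambda>n. cmod (\<Sum>k<m. e k n)) F \<le> a * (1 / (1 - q))" for m
    proof -
      have "L2_set (\<lambda>n. cmod (\<Sum>k<m. e k n)) F \<le> (\<Sum>k<m. a * q ^ k)"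
        using partial[of m] L2_set_le_ell2_norm[OF _ F] order_trans by blast
      also have "\<dots> \<le> (\<Sum>k. a * q ^ k)"
        by (rule sum_le_suminf) (use geo q in \<open>auto simp: sums_iff a_def\<close>)
      finally show ?thesis using geo by (simp add: sums_iff)
    qed
    ultimately show "L2_set (\<lambda>n. cmod (u n)) F \<le> a * (1 / (1 - q))"
      by (intro LIMSEQ_le_const2) auto
  qed
  \<comment> \<open>Since \<open>e (Suc k) = R (e k)\<close>, the terms of \<open>\<tau> D\<^sup>* D u\<close> telescope.\<close>
  have "?E (?D u) n = \<eta> n" for n
  proof -
    have "(\<lambda>k. complex_of_real \<tau> * ?E (?D (e k)) n) sums (complex_of_real \<tau> * ?E (?D u) n)"
      by (intro sums_mult schroedinger_minus_sums u)
    moreover have "complex_of_real \<tau> * ?E (?D (e k)) n = e k n - e (Suc k) n" for k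
    proof -
      have "e (Suc k) = R (e k)" by (simp add: e_def)
      thus ?thesis by (simp add: R_def)
    qed
    moreover have "(\<lambda>k. e k n - e (Suc k) n) sums (e 0 n - 0)"
      by (rule telescope_sums') (use u summable_LIMSEQ_zero sums_summable in blast)
    ultimately have "complex_of_real \<tau> * ?E (?D u) n = e 0 n"
      by (simp add: sums_iff)
    thus ?thesis using \<tau> by (simp add: e_def)
  qed
  thus ?thesis using u_ell2 by (intro bexI[of _ "?D u"] schroedinger_minus_in_ell2) auto
qed

text \<open>The bound at \<open>z\<close> gives injectivity and the norm of the inverse; surjectivity comes from the
  bound for the adjoint, that is, at \<open>cnj z\<close>.\<close>

lemma not_spectrum_of_bounded_below:
  assumes c: "0 < c" "bounded_below V z c"
    and c': "0 < c'" "bounded_below V (cnj z) c'"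
  shows "z \<notin> ell2_spectrum (schroedinger V)"
proof -
  let ?D = "schroedinger_minus V z"
  have inj: "\<phi> = \<psi>" if "\<phi> \<in> ell2_int" "\<psi> \<in> ell2_int" "?D \<phi> = ?D \<psi>" for \<phi> \<psi>
  proof
    fix n
    have d: "(\<lambda>n. \<phi> n - \<psi> n) \<in> ell2_int" using that by (intro ell2_int_diff)
    have "c * ell2_norm (\<lambda>n. \<phi> n - \<psi> n) \<le> ell2_norm (?D (\<lambda>n. \<phi> n - \<psi> n))"
      using c d by (simp add: bounded_below_def)
    also have "\<dots> = 0" by (simp add: schroedinger_minus_diff that ell2_norm_def)
    finally have "ell2_norm (\<lambda>n. \<phi> n - \<psi> n) \<le> 0" using c by (simp add: mult_le_0_iff)
    with cmod_le_ell2_norm[OF d, of n] have "cmod (\<phi> n - \<psi> n) \<le> 0" by linarith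
    thus "\<phi> n = \<psi> n" by simp
  qed
  have "\<forall>\<eta>\<in>ell2_int. \<exists>v\<in>ell2_int. ?D v = \<eta>"
    using surjective_of_bounded_below[OF c'] by simp
  then obtain B where B: "\<And>\<eta>. \<eta> \<in> ell2_int \<Longrightarrow> B \<eta> \<in> ell2_int"
    and DB: "\<And>\<eta>. \<eta> \<in> ell2_int \<Longrightarrow> ?D (B \<eta>) = \<eta>" by metis
  have BD: "B (?D \<psi>) = \<psi>" if "\<psi> \<in> ell2_int" for \<psi>
    using that B DB schroedinger_minus_in_ell2 by (intro inj[OF _ that]) blast+
  have add: "B (\<lambda>n. \<phi> n + \<psi> n) = (\<lambda>n. B \<phi> n + B \<psi> n)" if "\<phi> \<in> ell2_int" "\<psi> \<in> ell2_int" for \<phi> \<psi>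
    by (rule inj) (simp_all add: that B DB ell2_int_add schroedinger_minus_add)
  have cmult: "B (\<lambda>n. a * \<psi> n) = (\<lambda>n. a * B \<psi> n)" if "\<psi> \<in> ell2_int" for a \<psi>
    by (rule inj) (simp_all add: that B DB ell2_int_cmult schroedinger_minus_cmult)
  have "ell2_norm (B \<psi>) \<le> (1 / c) * ell2_norm \<psi>" if "\<psi> \<in> ell2_int" for \<psi>
  proof -
    have "c * ell2_norm (B \<psi>) \<le> ell2_norm \<psi>"
      using c B[OF that] DB[OF that] unfolding bounded_below_def by metis
    thus ?thesis using c by (simp add: field_simps)
  qed
  hence "ell2_bounded_operator B"
    using B add cmult unfolding ell2_bounded_operator_def by blast
  thus ?thesis using BD DB unfolding ell2_spectrum_def schroedinger_minus_def by blast
qed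

lemma not_spectrum_imp_bounded_below:
  assumes "z \<notin> ell2_spectrum (schroedinger V)"
  shows "\<exists>c>0. bounded_below V z c"
proof -
  obtain B where B: "ell2_bounded_operator B"
    and BD: "\<And>\<psi>. \<psi> \<in> ell2_int \<Longrightarrow> B (schroedinger_minus V z \<psi>) = \<psi>"
    using assms unfolding ell2_spectrum_def schroedinger_minus_def by blast
  then obtain C where C: "\<And>\<psi>. \<psi> \<in> ell2_int \<Longrightarrow> ell2_norm (B \<psi>) \<le> C * ell2_norm \<psi>"
    unfolding ell2_bounded_operator_def by blast
  have "bounded_below V z (1 / (\<bar>C\<bar> + 1))"
    unfolding bounded_below_def
  proof
    fix \<psi> :: "int \<Rightarrow> complex" assume \<psi>: "\<psi> \<in> ell2_int"
    have "ell2_norm \<psi> \<le> C * ell2_norm (schroedinger_minus V z \<psi>)"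
      using C[OF schroedinger_minus_in_ell2[OF \<psi>]] BD[OF \<psi>] by metis
    also have "\<dots> \<le> (\<bar>C\<bar> + 1) * ell2_norm (schroedinger_minus V z \<psi>)"
      by (intro mult_right_mono) auto
    finally show "1 / (\<bar>C\<bar> + 1) * ell2_norm \<psi> \<le> ell2_norm (schroedinger_minus V z \<psi>)"
      by (simp add: field_simps)
  qed
  thus ?thesis by (intro exI[of _ "1 / (\<bar>C\<bar> + 1)"]) auto
qed

end

definition approximate_eigenvalues :: "(int \<Rightarrow> real) \<Rightarrow> real set" where
  "approximate_eigenvalues V = {x. \<forall>c>0. \<not> bounded_below V (complex_of_real x) c}"

text \<open>The spectrum is real because \<open>H - z\<close> is bounded below by \<open>\<bar>Im z\<bar>\<close>, and at a real \<open>z\<close> the two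
  conditions for invertibility, at \<open>z\<close> and at \<open>cnj z\<close>, are the same.\<close>

lemma ell2_spectrum_schroedinger:
  assumes V: "bounded (range V)"
  shows "ell2_spectrum (schroedinger V) = complex_of_real ` approximate_eigenvalues V"
proof (intro equalityI subsetI)
  fix z assume z: "z \<in> ell2_spectrum (schroedinger V)"
  have "Im z = 0"
  proof (rule ccontr)
    assume "Im z \<noteq> 0"
    thus False
      using not_spectrum_of_bounded_below[OF V _ bounded_below_Im[OF V] _ bounded_below_Im[OF V],
          where z = z] z by auto
  qed
  hence real: "z = complex_of_real (Re z)" by (simp add: complex_eq_iff)
  hence "cnj z = z" by (metis complex_cnj_complex_of_real)
  hence "\<not> bounded_below V z c" if "0 < c" for c
    using not_spectrum_of_bounded_below[OF V that _ that, where z = z] z by auto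
  thus "z \<in> complex_of_real ` approximate_eigenvalues V"
    using real by (auto simp: approximate_eigenvalues_def intro!: image_eqI[of _ _ "Re z"])
next
  fix z assume "z \<in> complex_of_real ` approximate_eigenvalues V"
  thus "z \<in> ell2_spectrum (schroedinger V)"
    using not_spectrum_imp_bounded_below[OF V, where z = z] by (auto simp: approximate_eigenvalues_def)
qed

lemma bounded_below_perturb:
  assumes V: "bounded (range V)" and c: "bounded_below V (complex_of_real x) c"
  shows "bounded_below V (complex_of_real y) (c - \<bar>y - x\<bar>)"
  unfolding bounded_below_def
proof
  fix \<psi> :: "int \<Rightarrow> complex" assume \<psi>: "\<psi> \<in> ell2_int"
  have "schroedinger_minus V (complex_of_real x) \<psi> =
      (\<lambda>n. schroedinger_minus V (complex_of_real y) \<psi> n + complex_of_real (y - x) * \<psi> n)"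
    by (auto simp: schroedinger_minus_def algebra_simps)
  hence "ell2_norm (schroedinger_minus V (complex_of_real x) \<psi>) \<le>
      ell2_norm (schroedinger_minus V (complex_of_real y) \<psi>)
        + ell2_norm (\<lambda>n. complex_of_real (y - x) * \<psi> n)"
    using ell2_norm_triangle[OF schroedinger_minus_in_ell2[OF V] ell2_int_cmult, OF \<psi> \<psi>] by metis
  thus "(c - \<bar>y - x\<bar>) * ell2_norm \<psi> \<le> ell2_norm (schroedinger_minus V (complex_of_real y) \<psi>)"
    using c \<psi> unfolding bounded_below_def ell2_norm_cmult norm_of_real
    by (fastforce simp: algebra_simps)
qed

text \<open>The set is closed because a lower bound survives small changes of \<open>x\<close>. It is bounded because
  \<open>H - x\<close> is bounded below by \<open>\<bar>x\<bar>\<close> minus a norm bound of \<open>H\<close>.\<close>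

lemma compact_approximate_eigenvalues:
  assumes V: "bounded (range V)"
  shows "compact (approximate_eigenvalues V)"
  unfolding compact_eq_bounded_closed
proof
  obtain C where C: "0 \<le> C" "\<And>\<psi>. \<psi> \<in> ell2_int \<Longrightarrow> ell2_norm (schroedinger V \<psi>) \<le> C * ell2_norm \<psi>"
    using schroedinger_norm_bound[OF V] by blast
  have below: "bounded_below V (complex_of_real x) (\<bar>x\<bar> - C)" for x
    unfolding bounded_below_def
  proof
    fix \<psi> :: "int \<Rightarrow> complex" assume \<psi>: "\<psi> \<in> ell2_int"
    have "(\<lambda>n. complex_of_real x * \<psi> n) =
        (\<lambda>n. schroedinger V \<psi> n - schroedinger_minus V (complex_of_real x) \<psi> n)"
      by (simp add: schroedinger_minus_def)
    hence "ell2_norm (\<lambda>n. complex_of_real x * \<psi> n) \<le>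
        ell2_norm (schroedinger V \<psi>) + ell2_norm (schroedinger_minus V (complex_of_real x) \<psi>)"
      using ell2_norm_triangle_diff[OF schroedinger_in_ell2[OF V] schroedinger_minus_in_ell2[OF V],
          OF \<psi> \<psi>] by metis
    thus "(\<bar>x\<bar> - C) * ell2_norm \<psi> \<le> ell2_norm (schroedinger_minus V (complex_of_real x) \<psi>)"
      using C(2)[OF \<psi>] unfolding ell2_norm_cmult norm_of_real by (simp add: algebra_simps)
  qed
  have "\<bar>x\<bar> \<le> C" if "x \<in> approximate_eigenvalues V" for x
  proof (rule ccontr)
    assume "\<not> \<bar>x\<bar> \<le> C"
    hence "0 < \<bar>x\<bar> - C" by simp
    with that below[of x] show False unfolding approximate_eigenvalues_def by blast
  qed
  thus "bounded (approximate_eigenvalues V)" unfolding bounded_iff real_norm_def by blast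
  have "open (- approximate_eigenvalues V)"
    unfolding open_dist
  proof
    fix x assume "x \<in> - approximate_eigenvalues V"
    then obtain c where c: "0 < c" "bounded_below V (complex_of_real x) c"
      by (auto simp: approximate_eigenvalues_def)
    have "y \<in> - approximate_eigenvalues V" if "dist y x < c" for y
    proof -
      have "0 < c - \<bar>y - x\<bar>" using that by (simp add: dist_real_def)
      with bounded_below_perturb[OF V c(2), of y] show ?thesis
        unfolding approximate_eigenvalues_def by blast
    qed
    thus "\<exists>e>0. \<forall>y. dist y x < e \<longrightarrow> y \<in> - approximate_eigenvalues V"
      using c(1) by blast
  qed
  thus "closed (approximate_eigenvalues V)" by (simp add: closed_def)
qed

section \<open>Limits of translates\<close>

definition limit_of_translates :: "(int \<Rightarrow> real) \<Rightarrow> (int \<Rightarrow> real) \<Rightarrow> bool" where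
  "limit_of_translates V W \<longleftrightarrow>
    (\<forall>F \<epsilon>. finite F \<longrightarrow> 0 < \<epsilon> \<longrightarrow> (\<exists>m. \<forall>n\<in>F. \<bar>V (m + n) - W n\<bar> < \<epsilon>))"

lemma bounded_below_translate:
  assumes "bounded_below V z c"
  shows "bounded_below (\<lambda>n. V (m + n)) z c"
  unfolding bounded_below_def
proof
  fix \<psi> :: "int \<Rightarrow> complex" assume "\<psi> \<in> ell2_int"
  hence "c * ell2_norm (\<lambda>n. \<psi> (n + (- m))) \<le> ell2_norm (schroedinger_minus V z (\<lambda>n. \<psi> (n + (- m))))"
    using assms ell2_int_shift unfolding bounded_below_def by blast
  moreover have "schroedinger_minus V z (\<lambda>n. \<psi> (n + (- m)))
      = (\<lambda>n. schroedinger_minus (\<lambda>n. V (m + n)) z \<psi> (n + (- m)))"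
    by (auto simp: schroedinger_minus_def schroedinger_def algebra_simps)
  ultimately show "c * ell2_norm \<psi> \<le> ell2_norm (schroedinger_minus (\<lambda>n. V (m + n)) z \<psi>)"
    using ell2_norm_shift[of "schroedinger_minus (\<lambda>n. V (m + n)) z \<psi>" "- m"]
    by (simp only: ell2_norm_shift)
qed

text \<open>For a fixed \<open>\<psi>\<close>, moving from a translate of \<open>V\<close> to \<open>W\<close> costs \<open>\<parallel>(V (m + \<cdot>) - W) \<psi>\<parallel>\<close>. Outside
  a finite set \<open>F\<close> this is small because \<open>\<psi>\<close> is, and on \<open>F\<close> the translate can be chosen close to
  \<open>W\<close>. So a lower bound for \<open>V\<close> is one for \<open>W\<close>.\<close>

lemma bounded_below_limit_of_translates:
  assumes V: "bounded (range V)" and W: "bounded (range W)"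
    and lim: "limit_of_translates V W" and below: "bounded_below V z c"
  shows "bounded_below W z c"
  unfolding bounded_below_def
proof (rule, rule field_le_epsilon)
  fix \<psi> :: "int \<Rightarrow> complex" and e :: real assume \<psi>: "\<psi> \<in> ell2_int" and e: "0 < e"
  obtain A B where AB: "\<And>n. \<bar>V n\<bar> \<le> A" "\<And>n. \<bar>W n\<bar> \<le> B"
    using V W by (auto simp: bounded_iff)
  define K where "K = (A + B) / 2"
  let ?g = "\<lambda>n. (cmod (\<psi> n))\<^sup>2"
  have g: "?g summable_on UNIV" using \<psi> by (simp add: ell2_int_def)
  define s where "s = infsum ?g UNIV"
  have s: "0 \<le> s" by (simp add: s_def infsum_nonneg)
  \<comment> \<open>\<open>a\<close> bounds the mass of \<open>\<psi>\<close> outside \<open>F\<close> and \<open>\<delta>\<close> the distance of the potentials on \<open>F\<close>; each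
    contributes at most half of \<open>e\<^sup>2\<close>. The added \<open>1\<close> keeps the denominators positive.\<close>
  define a where "a = e\<^sup>2 / (2 * (4 * K\<^sup>2 + 1))"
  define \<delta> where "\<delta> = sqrt (e\<^sup>2 / (2 * (s + 1)))"
  have "0 < 4 * K\<^sup>2 + 1" using zero_le_power2[of K] by linarith
  hence a: "0 < a" "4 * K\<^sup>2 * a \<le> e\<^sup>2 / 2"
    using e unfolding a_def by (auto simp: field_simps)
  have \<delta>: "0 < \<delta>" "\<delta>\<^sup>2 * s \<le> e\<^sup>2 / 2"
    using e s unfolding \<delta>_def by (auto simp: field_simps)
  obtain F where F: "finite F" "s - a < sum ?g F"
  proof -
    have "\<not> (\<forall>F. finite F \<longrightarrow> sum ?g F \<le> s - a)"
      using infsum_le_finite_sums[OF g, of "s - a"] a by (auto simp: s_def)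
    thus thesis using that by (meson not_le)
  qed
  obtain m where m: "\<And>n. n \<in> F \<Longrightarrow> \<bar>V (m + n) - W n\<bar> < \<delta>"
    using lim F(1) \<delta>(1) unfolding limit_of_translates_def by meson
  let ?r = "\<lambda>n. complex_of_real (V (m + n) - W n) * \<psi> n"
  have r_le: "L2_set (\<lambda>n. cmod (?r n)) G \<le> e" if G: "finite G" for G
  proof -
    have "(\<Sum>n\<in>G. (cmod (?r n))\<^sup>2) \<le> (\<Sum>n\<in>G. \<delta>\<^sup>2 * ?g n + (if n \<in> F then 0 else 4 * K\<^sup>2 * ?g n))"
    proof (rule sum_mono)
      fix n
      have eq: "(cmod (?r n))\<^sup>2 = \<bar>V (m + n) - W n\<bar>\<^sup>2 * ?g n"
        by (simp only: norm_mult norm_of_real power_mult_distrib)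
      show "(cmod (?r n))\<^sup>2 \<le> \<delta>\<^sup>2 * ?g n + (if n \<in> F then 0 else 4 * K\<^sup>2 * ?g n)"
      proof (cases "n \<in> F")
        case True
        have "\<bar>V (m + n) - W n\<bar>\<^sup>2 \<le> \<delta>\<^sup>2" using m[OF True] by (intro power_mono) auto
        thus ?thesis using True unfolding eq by (simp add: mult_right_mono)
      next
        case False
        have "\<bar>V (m + n) - W n\<bar> \<le> 2 * K" 
          using AB(1)[of "m + n"] AB(2)[of n] abs_triangle_ineq4[of "V (m + n)" "W n"] by (simp add: K_def)
        hence "\<bar>V (m + n) - W n\<bar>\<^sup>2 \<le> (2 * K)\<^sup>2" by (rule power_mono) simp
        hence "\<bar>V (m + n) - W n\<bar>\<^sup>2 * ?g n \<le> 4 * K\<^sup>2 * ?g n"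
          by (intro mult_right_mono) (auto simp: power_mult_distrib)
        moreover have "0 \<le> \<delta>\<^sup>2 * ?g n" by simp
        ultimately have "\<bar>V (m + n) - W n\<bar>\<^sup>2 * ?g n \<le> \<delta>\<^sup>2 * ?g n + 4 * K\<^sup>2 * ?g n" by linarith
        thus ?thesis using False unfolding eq by simp
      qed
    qed
    also have "\<dots> = \<delta>\<^sup>2 * sum ?g G + 4 * K\<^sup>2 * sum ?g (G - F)"
      using G by (simp add: sum.distrib sum_distrib_left sum.If_cases set_diff_eq Int_def)
    also have "\<dots> \<le> \<delta>\<^sup>2 * s + 4 * K\<^sup>2 * a"
    proof -
      have "sum ?g G \<le> s" unfolding s_def by (rule finite_sum_le_infsum[OF g G]) auto
      moreover have "sum ?g (F \<union> (G - F)) \<le> s"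
        unfolding s_def using F G by (intro finite_sum_le_infsum[OF g]) auto
      moreover have "sum ?g (F \<union> (G - F)) = sum ?g F + sum ?g (G - F)"
        using F G by (intro sum.union_disjoint) auto
      ultimately have "sum ?g (G - F) \<le> a" "sum ?g G \<le> s" using F by linarith+
      thus ?thesis by (intro add_mono mult_left_mono) auto
    qed
    also have "\<dots> \<le> e\<^sup>2" using a \<delta> by linarith
    finally show ?thesis unfolding L2_set_def using e by (simp add: real_le_lsqrt)
  qed
  note r = ell2_norm_le_finite[OF r_le]
  have "c * ell2_norm \<psi> \<le> ell2_norm (schroedinger_minus (\<lambda>n. V (m + n)) z \<psi>)"
    using bounded_below_translate[OF below] \<psi> unfolding bounded_below_def by blast
  also have "schroedinger_minus (\<lambda>n. V (m + n)) z \<psi> = (\<lambda>n. schroedinger_minus W z \<psi> n + ?r n)"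
    by (auto simp: schroedinger_minus_def schroedinger_def algebra_simps)
  also have "ell2_norm \<dots> \<le> ell2_norm (schroedinger_minus W z \<psi>) + ell2_norm ?r"
    by (intro ell2_norm_triangle schroedinger_minus_in_ell2[OF W] \<psi> r)
  also have "\<dots> \<le> ell2_norm (schroedinger_minus W z \<psi>) + e" using r by simp
  finally show "c * ell2_norm \<psi> \<le> ell2_norm (schroedinger_minus W z \<psi>) + e" .
qed

lemma approximate_eigenvalues_limit_of_translates:
  assumes "bounded (range V)" "bounded (range W)" "limit_of_translates V W"
  shows "approximate_eigenvalues W \<subseteq> approximate_eigenvalues V"
  using bounded_below_limit_of_translates[OF assms] unfolding approximate_eigenvalues_def by blast

section \<open>Return times of a minimal homeomorphism\<close>

context
  fixes X :: "'a::metric_space set" and T S :: "'a \<Rightarrow> 'a"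
  assumes hom: "homeomorphism X X T S"
begin

lemma inv_into_eq: "x \<in> X \<Longrightarrow> inv_into X T x = S x"
  using hom by (metis homeomorphism_def homeomorphism_apply2 image_eqI inv_into_f_f inj_on_inverseI)

lemma T_in: "x \<in> X \<Longrightarrow> T x \<in> X" and S_in: "x \<in> X \<Longrightarrow> S x \<in> X"
  using hom by (auto simp: homeomorphism_def)

lemma continuous_on_funpow:
  assumes "continuous_on X g" "\<And>x. x \<in> X \<Longrightarrow> g x \<in> X"
  shows "continuous_on X (g ^^ k) \<and> (g ^^ k) ` X \<subseteq> X"
proof (induction k)
  case (Suc k)
  have "continuous_on X (g \<circ> (g ^^ k))"
    using Suc assms(1) by (intro continuous_on_compose) (auto intro: continuous_on_subset)
  thus ?case using Suc assms by auto
qed (simp add: id_def)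

lemma continuous_on_int_iterate: "continuous_on X (int_iterate X T n)"
  and int_iterate_in: "x \<in> X \<Longrightarrow> int_iterate X T n x \<in> X"
proof -
  have S: "continuous_on X (inv_into X T)" "\<And>x. x \<in> X \<Longrightarrow> inv_into X T x \<in> X"
    using hom S_in inv_into_eq by (auto simp: homeomorphism_def cong: continuous_on_cong)
  have "continuous_on X (int_iterate X T n) \<and> int_iterate X T n ` X \<subseteq> X"
    using continuous_on_funpow[of T "nat n"] continuous_on_funpow[OF S, of "nat (- n)"] hom T_in
    by (simp add: int_iterate_def homeomorphism_def)
  thus "continuous_on X (int_iterate X T n)" "x \<in> X \<Longrightarrow> int_iterate X T n x \<in> X" by auto
qed

lemma int_iterate_Suc:
  assumes "x \<in> X"
  shows "int_iterate X T (n + 1) x = T (int_iterate X T n x)"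
proof (cases "0 \<le> n")
  case True
  thus ?thesis by (simp add: int_iterate_def nat_add_distrib)
next
  case False
  define k where "k = nat (- n - 1)"
  have k: "n = - int (Suc k)" using False by (simp add: k_def)
  have in_X: "int_iterate X T (- int k) x \<in> X" using assms by (rule int_iterate_in)
  have "int_iterate X T n x = inv_into X T (int_iterate X T (- int k) x)"
    by (cases k) (auto simp: k int_iterate_def nat_add_distrib)
  hence "T (int_iterate X T n x) = int_iterate X T (- int k) x"
    using in_X hom inv_into_eq by (simp add: homeomorphism_def)
  thus ?thesis by (simp add: k)
qed

lemma int_iterate_add:
  assumes "x \<in> X"
  shows "int_iterate X T (m + n) x = int_iterate X T n (int_iterate X T m x)"
proof -
  have m: "int_iterate X T m x \<in> X" using assms by (rule int_iterate_in)
  have T_inj: "y = z" if "y \<in> X" "z \<in> X" "T y = T z" for y z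
    using that hom by (metis homeomorphism_apply1)
  show ?thesis
  proof (induction n rule: int_induct[where k = 0])
    case base
    show ?case by (simp add: int_iterate_def)
  next
    case (step1 i)
    thus ?case using int_iterate_Suc[OF assms, of "m + i"] int_iterate_Suc[OF m, of i]
      by (simp add: add.assoc)
  next
    case (step2 i)
    show ?case
    proof (rule T_inj)
      show "T (int_iterate X T (m + (i - 1)) x) = T (int_iterate X T (i - 1) (int_iterate X T m x))"
        using step2 int_iterate_Suc[OF assms, of "m + (i - 1)"] int_iterate_Suc[OF m, of "i - 1"]
        by simp
    qed (use assms m int_iterate_in in auto)
  qed
qed

end

text \<open>By compactness, every point of \<open>X\<close> enters \<open>U\<close> within a number of steps bounded
  independently of the point. Hence the times at which a single orbit visits \<open>U\<close> have bounded gaps.\<close>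

lemma infinite_return_times:
  fixes X :: "'a::metric_space set"
  assumes X: "compact X" and min: "minimal_homeomorphism X T"
    and U: "openin (top_of_set X) U" "U \<noteq> {}" and x: "x \<in> X"
  shows "infinite {m. int_iterate X T m x \<in> U}"
proof
  assume fin: "finite {m. int_iterate X T m x \<in> U}" (is "finite ?M")
  obtain S where hom: "homeomorphism X X T S"
    and dense: "\<And>x. x \<in> X \<Longrightarrow> X \<subseteq> closure (range (\<lambda>n. int_iterate X T n x))"
    using min by (auto simp: minimal_homeomorphism_def)
  note in_X = int_iterate_in[OF hom]
  obtain G where G: "open G" "U = X \<inter> G" using U by (auto simp: openin_open)
  have hit: "\<exists>n. int_iterate X T n y \<in> U" if y: "y \<in> X" for y
  proof -
    obtain z where "z \<in> X" "z \<in> G" using U G by auto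
    hence "z \<in> closure (range (\<lambda>n. int_iterate X T n y))" using dense y by auto
    hence "G \<inter> range (\<lambda>n. int_iterate X T n y) \<noteq> {}"
      using G \<open>z \<in> G\<close> open_Int_closure_eq_empty by fastforce
    thus ?thesis using G in_X y by auto
  qed
  have "\<exists>H. open H \<and> X \<inter> int_iterate X T n -` G = X \<inter> H" for n
    using continuous_on_int_iterate[OF hom, of n] G(1)
    by (metis continuous_on_open_invariant Int_commute)
  then obtain H where H: "\<And>n. open (H n)" "\<And>n. X \<inter> int_iterate X T n -` G = X \<inter> H n"
    by metis
  have cover: "X \<subseteq> (\<Union>n\<in>UNIV. H n)"
  proof
    fix y assume y: "y \<in> X"
    then obtain n where "int_iterate X T n y \<in> U" using hit by blast
    thus "y \<in> (\<Union>n\<in>UNIV. H n)" using G H(2)[of n] y by auto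
  qed
  obtain N where N: "finite N" "X \<subseteq> (\<Union>n\<in>N. H n)"
    by (rule compactE_image[OF X, of UNIV H]) (use H(1) cover in auto)
  have "UNIV = (\<Union>n\<in>N. (\<lambda>m. m - n) ` ?M)"
  proof (rule UNIV_eq_I)
    fix k
    have k: "int_iterate X T k x \<in> X" using x by (rule in_X)
    then obtain n where "n \<in> N" "int_iterate X T k x \<in> H n" using N(2) by auto
    hence n: "n \<in> N" "int_iterate X T n (int_iterate X T k x) \<in> G" using H(2)[of n] k by auto
    hence "int_iterate X T (k + n) x \<in> U"
      using G x in_X by (simp add: int_iterate_add[OF hom])
    thus "k \<in> (\<Union>n\<in>N. (\<lambda>m. m - n) ` ?M)" using n by (auto intro!: bexI[of _ n] image_eqI[of _ _ "k + n"])
  qed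
  moreover have "finite (\<Union>n\<in>N. (\<lambda>m. m - n) ` ?M)" using N fin by auto
  ultimately show False using infinite_UNIV_int by metis
qed

text \<open>The deterministic sequence must come close to its limit at infinitely many times, so that the
  independent random sequence has infinitely many chances to match a given block at such a time.\<close>

definition recurrent_limit :: "(int \<Rightarrow> real) \<Rightarrow> (int \<Rightarrow> real) \<Rightarrow> bool" where
  "recurrent_limit a b \<longleftrightarrow>
    (\<forall>F \<epsilon>. finite F \<longrightarrow> 0 < \<epsilon> \<longrightarrow> infinite {m. \<forall>n\<in>F. \<bar>a (m + n) - b n\<bar> < \<epsilon>})"

text \<open>By continuity, the points that stay \<open>\<epsilon>\<close>-close to \<open>y\<close>, as seen by \<open>f\<close>, at all times in \<open>F\<close> form a
  neighbourhood of \<open>y\<close>, and the orbit of \<open>x\<close> visits it infinitely often.\<close>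

lemma recurrent_limit_minimal:
  fixes X :: "'a::metric_space set"
  assumes X: "compact X" and min: "minimal_homeomorphism X T" and f: "continuous_on X f"
    and x: "x \<in> X" and y: "y \<in> X"
  shows "recurrent_limit (\<lambda>n. f (int_iterate X T n x)) (\<lambda>n. f (int_iterate X T n y))"
  unfolding recurrent_limit_def
proof (intro allI impI)
  fix F :: "int set" and \<epsilon> :: real assume F: "finite F" and \<epsilon>: "0 < \<epsilon>"
  obtain S where hom: "homeomorphism X X T S" using min by (auto simp: minimal_homeomorphism_def)
  let ?a = "\<lambda>x n. f (int_iterate X T n x)"
  define U where "U = {w \<in> X. \<forall>n\<in>F. \<bar>?a w n - ?a y n\<bar> < \<epsilon>}"
  have "openin (top_of_set X) {w \<in> X. \<bar>?a w n - ?a y n\<bar> < \<epsilon>}" for n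
  proof -
    have "continuous_on X (\<lambda>w. f (int_iterate X T n w))"
      using continuous_on_int_iterate[OF hom] int_iterate_in[OF hom]
      by (intro continuous_on_compose2[OF f]) auto
    from continuous_openin_preimage_gen[OF this open_ball[of "?a y n" \<epsilon>]]
    show ?thesis by (auto simp: dist_real_def abs_minus_commute vimage_def Int_def)
  qed
  hence "openin (top_of_set X) (X \<inter> (\<Inter>n\<in>F. {w \<in> X. \<bar>?a w n - ?a y n\<bar> < \<epsilon>}))"
    using F by (cases "F = {}") (auto intro!: openin_Int openin_INT simp: openin_subtopology_self)
  also have "X \<inter> (\<Inter>n\<in>F. {w \<in> X. \<bar>?a w n - ?a y n\<bar> < \<epsilon>}) = U" by (auto simp: U_def)
  finally have "infinite {m. int_iterate X T m x \<in> U}"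
    using y \<epsilon> by (intro infinite_return_times[OF X min _ _ x]) (auto simp: U_def)
  moreover have "{m. int_iterate X T m x \<in> U} = {m. \<forall>n\<in>F. \<bar>?a x (m + n) - ?a y n\<bar> < \<epsilon>}"
    using x int_iterate_in[OF hom] by (auto simp: U_def int_iterate_add[OF hom])
  ultimately show "infinite {m. \<forall>n\<in>F. \<bar>?a x (m + n) - ?a y n\<bar> < \<epsilon>}" by simp
qed

section \<open>Recurrence of blocks in a random sequence\<close>

text \<open>The complement of the support is the union of the null sets in a countable basis.\<close>

lemma AE_topological_support:
  fixes \<nu> :: "'a::second_countable_topology measure"
  assumes "sets \<nu> = sets borel"
  shows "AE t in \<nu>. t \<in> topological_support \<nu>"
proof -
  obtain B :: "'a set set" where B: "countable B" "topological_basis B"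
    using ex_countable_basis by blast
  define N where "N = {U\<in>B. emeasure \<nu> U = 0}"
  have "(\<Union>U\<in>N. U) \<in> null_sets \<nu>"
  proof (rule null_sets_UN')
    show "countable N" using B by (auto simp: N_def intro: countable_subset)
    show "U \<in> null_sets \<nu>" if "U \<in> N" for U
      using that topological_basis_open[OF B(2), of U] assms by (auto simp: N_def null_sets_def)
  qed
  moreover have "{t\<in>space \<nu>. \<not> t \<in> topological_support \<nu>} \<subseteq> (\<Union>U\<in>N. U)"
  proof
    fix t assume "t \<in> {t\<in>space \<nu>. \<not> t \<in> topological_support \<nu>}"
    then obtain G where G: "open G" "t \<in> G" "emeasure \<nu> G = 0"
      by (auto simp: topological_support_def)
    then obtain U where U: "U \<in> B" "t \<in> U" "U \<subseteq> G" using B by (meson topological_basisE)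
    have "G \<in> sets \<nu>" using G assms by simp
    hence "emeasure \<nu> U = 0" using G U emeasure_mono[of U G \<nu>] by simp
    thus "t \<in> (\<Union>U\<in>N. U)" using U by (auto simp: N_def)
  qed
  ultimately show ?thesis by (rule AE_I')
qed

lemma infinite_int_sparse_sequence:
  fixes S :: "int set" and L :: int
  assumes S: "infinite S"
  obtains s :: "nat \<Rightarrow> int" where "range s \<subseteq> S" "\<And>i j. i \<noteq> j \<Longrightarrow> L < \<bar>s i - s j\<bar>"
proof -
  have step: "\<exists>t\<in>S. K < \<bar>t\<bar>" for K :: int
  proof (rule ccontr)
    assume "\<not> (\<exists>t\<in>S. K < \<bar>t\<bar>)"
    hence "S \<subseteq> {- K..K}" by force
    thus False using S finite_subset by blast
  qed
  have "\<exists>s. \<forall>n. s n \<in> S \<and> \<bar>s n\<bar> + max L 0 < \<bar>s (Suc n)\<bar>"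
    by (rule dependent_nat_choice) (use step in blast)+
  then obtain s where s: "\<And>n. s n \<in> S" "\<And>n. \<bar>s n\<bar> + max L 0 < \<bar>s (Suc n)\<bar>" by blast
  have lt: "L < \<bar>s j\<bar> - \<bar>s i\<bar>" if "i < j" for i j
    using that
  proof (induction rule: strict_inc_induct)
    case (base i)
    thus ?case using s(2)[of i] by simp
  next
    case (step i)
    thus ?case using s(2)[of i] by linarith
  qed
  have "L < \<bar>s i - s j\<bar>" if "i \<noteq> j" for i j
    using lt[of i j] lt[of j i] that by (cases "i < j") linarith+
  thus thesis using s(1) by (intro that[of s]) auto
qed

text \<open>Along a sparse sequence of positions the blocks occupy disjoint sets of coordinates, so their
  occurrences are independent events of equal positive probability, and the zero-one law applies.\<close>

lemma AE_block_occurs: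
  fixes \<nu> :: "'b measure" and S F :: "int set"
  assumes \<nu>: "prob_space \<nu>" and S: "infinite S" and F: "finite F"
    and A: "\<And>n. n \<in> F \<Longrightarrow> A n \<in> sets \<nu>" "\<And>n. n \<in> F \<Longrightarrow> 0 < measure \<nu> (A n)"
  shows "AE \<omega> in Pi\<^sub>M UNIV (\<lambda>_. \<nu>). \<exists>m\<in>S. \<forall>n\<in>F. \<omega> (m + n) \<in> A n"
proof -
  let ?P = "Pi\<^sub>M (UNIV :: int set) (\<lambda>_. \<nu>)"
  interpret prod: product_prob_space "\<lambda>_::int. \<nu>" UNIV
    by (rule product_prob_spaceI) (rule \<nu>)
  obtain L where L: "\<And>n n'. n \<in> F \<Longrightarrow> n' \<in> F \<Longrightarrow> \<bar>n - n'\<bar> \<le> L"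
  proof
    show "\<bar>n - n'\<bar> \<le> 2 * (\<Sum>k\<in>F. \<bar>k\<bar>)" if "n \<in> F" "n' \<in> F" for n n'
      using member_le_sum[of n F abs] member_le_sum[of n' F abs] that F by auto
  qed
  obtain s :: "nat \<Rightarrow> int" where s: "range s \<subseteq> S" "\<And>i j. i \<noteq> j \<Longrightarrow> L < \<bar>s i - s j\<bar>"
    using infinite_int_sparse_sequence[OF S] by metis
  define E where "E k = {\<omega>\<in>space ?P. \<forall>n\<in>F. \<omega> (s k + n) \<in> A n}" for k
  define p where "p = (\<Prod>n\<in>F. measure \<nu> (A n))"
  have p: "0 < p" unfolding p_def using A by (intro prod_pos) auto
  let ?I = "\<lambda>k. (\<lambda>n. s k + n) ` F"
  have disj: "k = k'" if i: "i \<in> ?I k" "i \<in> ?I k'" for i k k'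
  proof (rule ccontr)
    assume ne: "k \<noteq> k'"
    obtain n n' where "n \<in> F" "n' \<in> F" "i = s k + n" "i = s k' + n'" using i by blast
    thus False using L[of n n'] s(2)[OF ne] by linarith
  qed
  \<comment> \<open>The set prescribed at a coordinate by the only block that covers it.\<close>
  define B where "B i = A (i - s (THE k. i \<in> ?I k))" for i
  have B: "B i = A (i - s k)" if "i \<in> ?I k" for i k
  proof -
    have "(THE k. i \<in> ?I k) = k" using that disj by (intro the_equality) auto
    thus ?thesis by (simp add: B_def)
  qed
  have B_sets: "B i \<in> sets \<nu>" if "i \<in> ?I k" for i k
    using that B[OF that] A by auto
  have inter: "measure ?P (\<Inter>k\<in>J. E k) = p ^ card J \<and> (\<Inter>k\<in>J. E k) \<in> sets ?P"
    if J: "J \<noteq> {}" "finite J" for J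
  proof -
    let ?U = "\<Union>k\<in>J. ?I k"
    have U: "finite ?U" using J F by auto
    have mem: "\<omega> i \<in> B i" if "\<omega> (s k + n) \<in> A n" "n \<in> F" "i = s k + n" for \<omega> i k n
      using that B[of i k] by auto
    have mem': "\<omega> (s k + n) \<in> A n" if "\<omega> (s k + n) \<in> B (s k + n)" "n \<in> F" for \<omega> k n
      using that B[of "s k + n" k] by auto
    have eq: "(\<Inter>k\<in>J. E k) = prod.emb UNIV ?U (Pi\<^sub>E ?U B)"
      using J mem mem' unfolding E_def prod_emb_def by (fastforce simp: space_PiM PiE_iff)
    have "measure ?P (\<Inter>k\<in>J. E k) = (\<Prod>i\<in>?U. measure \<nu> (B i))"
      unfolding eq using U B_sets by (intro prod.measure_PiM_emb) auto
    also have "\<dots> = (\<Prod>k\<in>J. \<Prod>i\<in>?I k. measure \<nu> (B i))"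
      using J F disj by (intro prod.UNION_disjoint) auto
    also have "\<dots> = (\<Prod>k\<in>J. \<Prod>n\<in>F. measure \<nu> (A n))"
    proof (rule prod.cong[OF refl])
      fix k
      have "(\<Prod>i\<in>?I k. measure \<nu> (B i)) = (\<Prod>n\<in>F. measure \<nu> (B (s k + n)))"
        by (subst prod.reindex) (auto simp: inj_on_def)
      also have "\<dots> = (\<Prod>n\<in>F. measure \<nu> (A n))"
        by (intro prod.cong) (auto simp: B[of _ k])
      finally show "(\<Prod>i\<in>?I k. measure \<nu> (B i)) = (\<Prod>n\<in>F. measure \<nu> (A n))" .
    qed
    finally have "measure ?P (\<Inter>k\<in>J. E k) = p ^ card J" by (simp add: p_def)
    moreover have "(\<Inter>k\<in>J. E k) \<in> sets ?P"
      unfolding eq using U B_sets by (intro measurable_prod_emb sets_PiM_I_finite) auto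
    ultimately show ?thesis by simp
  qed
  have E: "E k \<in> sets ?P" "measure ?P (E k) = p" for k
    using inter[of "{k}"] by auto
  have "prod.indep_events E UNIV"
    by (intro prod.indep_eventsI) (use E inter in auto)
  hence "(AE \<omega> in ?P. infinite {k. \<forall>n\<in>F. \<omega> (s k + n) \<in> A n}) \<or>
      (AE \<omega> in ?P. finite {k. \<forall>n\<in>F. \<omega> (s k + n) \<in> A n})"
    unfolding E_def by (rule prod.borel_0_1_law_AE)
  thus ?thesis
  proof
    assume "AE \<omega> in ?P. infinite {k. \<forall>n\<in>F. \<omega> (s k + n) \<in> A n}"
    thus ?thesis
    proof (rule AE_mp, intro AE_I2 impI)
      fix \<omega> assume "infinite {k. \<forall>n\<in>F. \<omega> (s k + n) \<in> A n}"
      then obtain k where "\<forall>n\<in>F. \<omega> (s k + n) \<in> A n"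
        using not_finite_existsD by blast
      thus "\<exists>m\<in>S. \<forall>n\<in>F. \<omega> (m + n) \<in> A n" using s(1) by blast
    qed
  next
    \<comment> \<open>Impossible: the sets \<open>G m\<close> decrease to a null set, although each has probability at least \<open>p\<close>.\<close>
    assume fin: "AE \<omega> in ?P. finite {k. \<forall>n\<in>F. \<omega> (s k + n) \<in> A n}"
    define G where "G m = (\<Union>k\<in>{m..}. E k)" for m
    have G: "range G \<subseteq> sets ?P" "decseq G"
      using E by (auto simp: G_def decseq_def intro: order_trans)
    have "AE \<omega> in ?P. \<omega> \<notin> (\<Inter>m. G m)"
      using fin
    proof (rule AE_mp, intro AE_I2 impI)
      fix \<omega> assume "finite {k. \<forall>n\<in>F. \<omega> (s k + n) \<in> A n}"
      from finite_nat_bounded[OF this] obtain m where "{k. \<forall>n\<in>F. \<omega> (s k + n) \<in> A n} \<subseteq> {..<m}" ..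
      hence "\<omega> \<notin> G m" by (force simp: G_def E_def)
      thus "\<omega> \<notin> (\<Inter>m. G m)" by blast
    qed
    hence "measure ?P (\<Inter>m. G m) = 0"
      using G prod.P.prob_eq_0 by auto
    hence "(\<lambda>m. measure ?P (G m)) \<longlonglongrightarrow> 0"
      using prod.P.finite_Lim_measure_decseq[OF G] by simp
    moreover have "p \<le> measure ?P (G m)" for m
      using E[of m] G prod.P.finite_measure_mono[of "E m" "G m"] by (auto simp: G_def)
    ultimately have "p \<le> 0" by (intro LIMSEQ_le_const) auto
    thus ?thesis using p by simp
  qed
qed

text \<open>A random sequence repeats every admissible block next to a prescribed recurrent pattern of
  \<open>a\<close>. Only countably many blocks with rational entries and rational accuracy have to be
  treated, so one null set of exceptions serves all limits \<open>b\<close> and all \<open>w\<close> at once.\<close>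

lemma AE_limit_of_translates:
  fixes \<nu> :: "real measure" and a :: "int \<Rightarrow> real"
  assumes \<nu>: "prob_space \<nu>" and borel: "sets \<nu> = sets borel"
  shows "AE \<omega> in Pi\<^sub>M UNIV (\<lambda>_. \<nu>). \<forall>b w. recurrent_limit a b \<longrightarrow>
    (\<forall>n. w n \<in> topological_support \<nu>) \<longrightarrow>
    limit_of_translates (\<lambda>n. a n + \<omega> n) (\<lambda>n. b n + w n)"
proof -
  let ?P = "Pi\<^sub>M (UNIV :: int set) (\<lambda>_. \<nu>)"
  interpret prob_space \<nu> by (rule \<nu>)
  define near where "near F \<epsilon> v r \<longleftrightarrow> (\<forall>n\<in>F. \<bar>v n - r n\<bar> < \<epsilon>)"
    for F :: "int set" and \<epsilon> :: real and v r :: "int \<Rightarrow> real"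
  \<comment> \<open>Extensional functions, so that each finite set of coordinates carries only countably many.\<close>
  define \<F> where "\<F> = (SIGMA F:{F :: int set. finite F}. ((F \<rightarrow>\<^sub>E (\<rat> :: real set)) \<times> (F \<rightarrow>\<^sub>E (\<rat> :: real set))) \<times> (\<rat> :: real set))"
  have "countable \<F>"
    unfolding \<F>_def
    using countable_Collect_finite[where 'a = int]
    by (intro countable_SIGMA countable_PiE countable_rat) auto
  have "AE \<omega> in ?P. \<forall>(F, (r, r'), \<epsilon>)\<in>\<F>. infinite {m. near F \<epsilon> (\<lambda>n. a (m + n)) r} \<longrightarrow>
      (\<forall>n\<in>F. 0 < measure \<nu> (ball (r' n) \<epsilon>)) \<longrightarrow>
      (\<exists>m. near F \<epsilon> (\<lambda>n. a (m + n)) r \<and> near F \<epsilon> (\<lambda>n. \<omega> (m + n)) r')"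
    unfolding AE_ball_countable[OF \<open>countable \<F>\<close>]
  proof clarify
    fix F r r' \<epsilon> assume "(F, (r, r'), \<epsilon>) \<in> \<F>"
    hence F: "finite F" by (simp add: \<F>_def)
    show "AE \<omega> in ?P. infinite {m. near F \<epsilon> (\<lambda>n. a (m + n)) r} \<longrightarrow>
      (\<forall>n\<in>F. 0 < measure \<nu> (ball (r' n) \<epsilon>)) \<longrightarrow>
      (\<exists>m. near F \<epsilon> (\<lambda>n. a (m + n)) r \<and> near F \<epsilon> (\<lambda>n. \<omega> (m + n)) r')"
    proof (cases "infinite {m. near F \<epsilon> (\<lambda>n. a (m + n)) r} \<and> (\<forall>n\<in>F. 0 < measure \<nu> (ball (r' n) \<epsilon>))")
      case True
      have "AE \<omega> in ?P. \<exists>m\<in>{m. near F \<epsilon> (\<lambda>n. a (m + n)) r}. \<forall>n\<in>F. \<omega> (m + n) \<in> ball (r' n) \<epsilon>"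
        using True borel by (intro AE_block_occurs \<nu> F) auto
      thus ?thesis
        by (rule AE_mp) (auto simp: near_def dist_real_def abs_minus_commute intro!: AE_I2)
    qed auto
  qed
  thus ?thesis
  proof (rule AE_mp, intro AE_I2 impI allI)
    fix \<omega> b w :: "int \<Rightarrow> real"
    assume *: "\<forall>(F, (r, r'), \<epsilon>)\<in>\<F>. infinite {m. near F \<epsilon> (\<lambda>n. a (m + n)) r} \<longrightarrow>
      (\<forall>n\<in>F. 0 < measure \<nu> (ball (r' n) \<epsilon>)) \<longrightarrow>
      (\<exists>m. near F \<epsilon> (\<lambda>n. a (m + n)) r \<and> near F \<epsilon> (\<lambda>n. \<omega> (m + n)) r')"
      and rec: "recurrent_limit a b" and w: "\<forall>n. w n \<in> topological_support \<nu>"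
    show "limit_of_translates (\<lambda>n. a n + \<omega> n) (\<lambda>n. b n + w n)"
      unfolding limit_of_translates_def
    proof (intro allI impI)
      fix F :: "int set" and e :: real assume F: "finite F" and e: "0 < e"
      \<comment> \<open>Both summands are off by less than \<open>\<epsilon>\<close> from the rational block, and the block by less
        than \<open>\<epsilon> / 2\<close> from the limit: in total less than \<open>3 \<epsilon>\<close>.\<close>
      obtain \<epsilon> where \<epsilon>: "\<epsilon> \<in> \<rat>" "0 < \<epsilon>" "\<epsilon> < e / 4"
        using Rats_dense_in_real[of 0 "e / 4"] e by auto
      have "\<exists>q\<in>\<rat>. \<bar>x - q\<bar> < \<epsilon> / 2" for x :: real
        using Rats_dense_in_real[of x "x + \<epsilon> / 2"] \<epsilon> by force
      then obtain \<rho> where \<rho>: "\<And>x. \<rho> x \<in> \<rat>" "\<And>x. \<bar>x - \<rho> x\<bar> < \<epsilon> / 2" by metis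
      define r where "r = restrict (\<lambda>n. \<rho> (b n)) F"
      define r' where "r' = restrict (\<lambda>n. \<rho> (w n)) F"
      have "(F, (r, r'), \<epsilon>) \<in> \<F>" using F \<epsilon> \<rho> by (auto simp: \<F>_def r_def r'_def)
      moreover have "infinite {m. near F \<epsilon> (\<lambda>n. a (m + n)) r}"
      proof -
        have "infinite {m. \<forall>n\<in>F. \<bar>a (m + n) - b n\<bar> < \<epsilon> / 2}"
          using rec F half_gt_zero[OF \<epsilon>(2)] unfolding recurrent_limit_def by blast
        moreover have "near F \<epsilon> (\<lambda>n. a (m + n)) r" if "\<forall>n\<in>F. \<bar>a (m + n) - b n\<bar> < \<epsilon> / 2" for m
          unfolding near_def
        proof
          fix n assume n: "n \<in> F"
          hence "\<bar>a (m + n) - b n\<bar> < \<epsilon> / 2" "r n = \<rho> (b n)" using that by (auto simp: r_def)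
          thus "\<bar>a (m + n) - r n\<bar> < \<epsilon>" using \<rho>(2)[of "b n"] by linarith
        qed
        hence "{m. \<forall>n\<in>F. \<bar>a (m + n) - b n\<bar> < \<epsilon> / 2} \<subseteq> {m. near F \<epsilon> (\<lambda>n. a (m + n)) r}" by blast
        ultimately show ?thesis using infinite_super by blast
      qed
      moreover have "0 < measure \<nu> (ball (r' n) \<epsilon>)" if "n \<in> F" for n
      proof -
        have "w n \<in> ball (r' n) \<epsilon>"
          using that \<rho>(2)[of "w n"] \<epsilon>(2) by (auto simp: r'_def dist_real_def abs_minus_commute)
        hence "0 < emeasure \<nu> (ball (r' n) \<epsilon>)"
          using w by (auto simp: topological_support_def)
        thus ?thesis by (simp add: emeasure_eq_measure)
      qed
      ultimately obtain m where m: "near F \<epsilon> (\<lambda>n. a (m + n)) r" "near F \<epsilon> (\<lambda>n. \<omega> (m + n)) r'"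
        using * by blast
      have "\<bar>a (m + n) + \<omega> (m + n) - (b n + w n)\<bar> < e" if n: "n \<in> F" for n
      proof -
        have "\<bar>a (m + n) - \<rho> (b n)\<bar> < \<epsilon>" "\<bar>\<omega> (m + n) - \<rho> (w n)\<bar> < \<epsilon>"
          using m n by (auto simp: near_def r_def r'_def)
        thus ?thesis using \<rho>(2)[of "b n"] \<rho>(2)[of "w n"] \<epsilon> by linarith
      qed
      thus "\<exists>m. \<forall>n\<in>F. \<bar>a (m + n) + \<omega> (m + n) - (b n + w n)\<bar> < e" by blast
    qed
  qed
qed

section \<open>The deterministic spectrum\<close>

theorem theorem1p1:
  fixes X :: "'a::metric_space set"
    and T :: "'a \<Rightarrow> 'a"
    and f :: "'a \<Rightarrow> real"
    and \<nu> :: "real measure"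
  assumes "compact X"
    and "minimal_homeomorphism X T"
    and "continuous_on X f"
    and "prob_space \<nu>"
    and "sets \<nu> = sets borel"
    and "compact (topological_support \<nu>)"
  shows "\<exists>\<Sigma> :: real set. compact \<Sigma> \<and>
    (\<forall>x\<in>X. AE \<omega> in Pi\<^sub>M (UNIV :: int set) (\<lambda>_. \<nu>).
       (\<forall>n. \<omega> n \<in> topological_support \<nu>) \<and>
       ell2_spectrum (schroedinger (\<lambda>n. f (int_iterate X T n x) + \<omega> n)) =
         complex_of_real ` \<Sigma>)"
proof -
  let ?P = "Pi\<^sub>M (UNIV :: int set) (\<lambda>_. \<nu>)"
  let ?K = "topological_support \<nu>"
  let ?a = "\<lambda>x n. f (int_iterate X T n x)"
  let ?V = "\<lambda>x \<omega> n. ?a x n + \<omega> n"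
  interpret P: prob_space ?P by (rule prob_space_PiM) (rule assms(4))
  obtain S where hom: "homeomorphism X X T S"
    using assms(2) by (auto simp: minimal_homeomorphism_def)
  have bdd: "bounded (range (?V x \<omega>))" if "x \<in> X" "\<forall>n. \<omega> n \<in> ?K" for x \<omega>
  proof -
    have "bounded (range (?a x))"
      using compact_imp_bounded[OF compact_continuous_image[OF assms(3,1)]]
      by (rule bounded_subset) (use that int_iterate_in[OF hom] in auto)
    moreover have "bounded (range \<omega>)"
      using compact_imp_bounded[OF assms(6)] by (rule bounded_subset) (use that in auto)
    ultimately show ?thesis by (rule bounded_plus_comp)
  qed
  \<comment> \<open>A typical realization has each of these sets in its spectrum, so nothing smaller would do.\<close>
  define \<Sigma> where "\<Sigma> = (\<Union>y\<in>X. \<Union>w\<in>{w. \<forall>n. w n \<in> ?K}. approximate_eigenvalues (?V y w))"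
  have ae: "AE \<omega> in ?P. (\<forall>n. \<omega> n \<in> ?K) \<and> approximate_eigenvalues (?V x \<omega>) = \<Sigma>" if x: "x \<in> X" for x
  proof -
    have "AE \<omega> in ?P. \<omega> n \<in> ?K" for n
      using AE_PiM_component[of UNIV "\<lambda>_. \<nu>" n "\<lambda>t. t \<in> ?K"] assms(4)
        AE_topological_support[OF assms(5)] by simp
    hence "AE \<omega> in ?P. \<forall>n. \<omega> n \<in> ?K" by (simp add: AE_all_countable)
    thus ?thesis using AE_limit_of_translates[OF assms(4,5), of "?a x"]
    proof eventually_elim
      case (elim \<omega>)
      have "approximate_eigenvalues (?V y w) \<subseteq> approximate_eigenvalues (?V x \<omega>)"
        if "y \<in> X" "\<forall>n. w n \<in> ?K" for y w
        using that x elim recurrent_limit_minimal[OF assms(1,2,3) x]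
        by (intro approximate_eigenvalues_limit_of_translates bdd) blast+
      thus ?case using elim x by (auto simp: \<Sigma>_def)
    qed
  qed
  show ?thesis
  proof (intro exI conjI ballI)
    show "compact \<Sigma>"
    proof (cases "X = {}")
      case False
      then obtain x where x: "x \<in> X" by blast
      obtain \<omega> where "\<forall>n. \<omega> n \<in> ?K" "approximate_eigenvalues (?V x \<omega>) = \<Sigma>"
        using eventually_happens[OF ae[OF x]] P.ae_filter_bot by auto
      thus ?thesis using compact_approximate_eigenvalues[OF bdd[OF x]] by metis
    qed (simp add: \<Sigma>_def)
    show "AE \<omega> in ?P. (\<forall>n. \<omega> n \<in> ?K) \<and>
        ell2_spectrum (schroedinger (?V x \<omega>)) = complex_of_real ` \<Sigma>" if "x \<in> X" for x
      using ae[OF that] by eventually_elim (use ell2_spectrum_schroedinger[OF bdd[OF that]] in auto)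
  qed
qed

end
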